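(* Let $\mu_1,\mu_2$ be nonzero real numbers, put $\mu_3=\mu_1$, $\mu_4=\mu_2$, and let $\bar\theta=(0,\pi/2,\pi,3\pi/2)$ be the $(1+4)$-gon (square) configuration. Then $\bar\theta$ is a nondegenerate critical point of $V$ except when the pairs of circulation parameters are in a $3:2$ ratio, i.e. except when $2\mu_1=3\mu_2$ or $3\mu_1=2\mu_2$. Moreover, the $(1+4)$-gon is never linearly stable in the sense of the criterion that $\mu^{-1}V_{\theta\theta}(\bar\theta)$ have $3$ positive eigenvalues.
   Context: The $(1+4)$-vortex problem: a dominant vortex of circulation $1$ is at the origin, and four infinitesimal vortices $v_1,v_2,v_3,v_4$ with circulation parameters $\mu_i\in\mathbb{R}\setminus\{0\}$ lie on the unit circle, $v_i$ being at the point with polar coordinates $(1,\theta_i)$, with the $\theta_i$ pairwise distinct modulo $2\pi$. Define $$V(\theta)=-\sum_{1\le i<j\le 4}\mu_i\mu_j\left[\cos(\theta_i-\theta_j)+\tfrac12\log\bigl(2-2\cos(\theta_i-\theta_j)\bigr)\right].$$ Configurations are critical points of $V$. $V_{\theta\theta}$ denotes the $4\times4$ Hessian matrix of $V$ and $\mu=\mathrm{diag}(\mu_1,\mu_2,\mu_3,\mu_4)$. Because of rotational symmetry $V_{\theta\theta}$ always has a zero eigenvalue at a critical point; a critical point $\bar\theta$ is nondegenerate if $V_{\theta\theta}(\bar\theta)$ has only one zero eigenvalue (counted with multiplicity), and degenerate otherwise. Linear stability criterion: a critical point $\bar\theta$ is called linearly stable if the weighted Hessian $\mu^{-1}V_{\theta\theta}(\bar\theta)$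 has $N-1=3$ positive eigenvalues (for nondegenerate $\bar\theta$ this is equivalent to linear stability of the relative equilibria with small positive $\varepsilon$ and circulations $\varepsilon\mu_i$ that converge to $\bar\theta$ as $\varepsilon\to0$). *)

theory Defs
  imports
    "HOL-Analysis.Analysis"
    "HOL-Computational_Algebra.Polynomial"
    "HOL-Library.Real_Mod"
begin

text \<open>
  Vortices and coordinates are indexed by the four-element type \<open>4\<close>.  Its numerals are taken
  modulo 4, so the index \<open>4\<close> is the element \<open>0\<close> and the order of the type does not agree with
  the labelling \<open>1, 2, 3, 4\<close>.  The pairs \<open>i < j\<close> are therefore listed explicitly.
\<close>

definition vortex_pairs :: "(4 \<times> 4) set" where
  "vortex_pairs = {(1,2), (1,3), (1,4), (2,3), (2,4), (3,4)}"

definition vortex_potential :: "real^4 \<Rightarrow> real^4 \<Rightarrow> real" where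
  "vortex_potential \<mu> \<theta> = - (\<Sum>(i,j)\<in>vortex_pairs. \<mu>$i * \<mu>$j *
      (cos (\<theta>$i - \<theta>$j) + 1/2 * ln (2 - 2 * cos (\<theta>$i - \<theta>$j))))"

definition admissible :: "real^4 \<Rightarrow> bool" where
  "admissible \<theta> \<longleftrightarrow> (\<forall>i j. i \<noteq> j \<longrightarrow> \<not> [\<theta>$i = \<theta>$j] (rmod (2 * pi)))"

definition critical_point :: "real^4 \<Rightarrow> real^4 \<Rightarrow> bool" where
  "critical_point \<mu> \<theta> \<longleftrightarrow> admissible \<theta> \<and> (vortex_potential \<mu> has_derivative (\<lambda>h. 0)) (at \<theta>)"

definition partial_deriv :: "'n \<Rightarrow> (real^'n \<Rightarrow> real) \<Rightarrow> real^'n \<Rightarrow> real" where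
  "partial_deriv i f x = deriv (\<lambda>t. f (x + t *\<^sub>R axis i 1)) 0"

definition hessian :: "(real^'n \<Rightarrow> real) \<Rightarrow> real^'n \<Rightarrow> real^'n^'n" where
  "hessian f x = (\<chi> i j. partial_deriv i (partial_deriv j f) x)"

definition diag_matrix :: "real^'n \<Rightarrow> real^'n^'n" where
  "diag_matrix d = (\<chi> i j. if i = j then d$i else 0)"

definition weighted_hessian :: "real^4 \<Rightarrow> real^4 \<Rightarrow> real^4^4" where
  "weighted_hessian \<mu> \<theta> = matrix_inv (diag_matrix \<mu>) ** hessian (vortex_potential \<mu>) \<theta>"

definition charpoly :: "real^'n^'n \<Rightarrow> real poly" where
  "charpoly A = det (mat [:0, 1:] - (\<chi> i j. [:A$i$j:]))"

text \<open>
  The number of real eigenvalues of \<open>A\<close> lying in \<open>S\<close>, counted with algebraic multiplicity.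
\<close>

definition eigenvalue_count :: "real^'n^'n \<Rightarrow> real set \<Rightarrow> nat" where
  "eigenvalue_count A S = (\<Sum>x | x \<in> S \<and> poly (charpoly A) x = 0. order x (charpoly A))"

definition nondegenerate :: "real^4 \<Rightarrow> real^4 \<Rightarrow> bool" where
  "nondegenerate \<mu> \<theta> \<longleftrightarrow> eigenvalue_count (hessian (vortex_potential \<mu>) \<theta>) {0} = 1"

definition linearly_stable :: "real^4 \<Rightarrow> real^4 \<Rightarrow> bool" where
  "linearly_stable \<mu> \<theta> \<longleftrightarrow> eigenvalue_count (weighted_hessian \<mu> \<theta>) {0<..} = 3"

definition square_configuration :: "real^4" where
  "square_configuration = vector [0, pi / 2, pi, 3 * pi / 2]"

end

theory Submission
  imports Defs
begin

text \<open>
  At the square every pair of neighbours contributes through the interaction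
  \<open>cos \<phi> + ln (2 - 2 * cos \<phi>) / 2\<close> at a quarter turn, and every pair of opposite vortices through
  the interaction at a half turn.  Its first derivative vanishes at a half turn, and the two
  neighbours of a vortex, which have equal circulations, act on it with opposite signs, so the
  square is a critical point (\<open>critical_point_square\<close>).  Its second derivative is \<open>-1/2\<close> at a
  quarter turn and \<open>3/4\<close> at a half turn, which determines the Hessian (\<open>hessian_square\<close>).

  Opposite vortices have equal circulations, hence the Hessian and the weighted Hessian commute
  with the half turn that exchanges opposite vortices.  They split into a block on the even vectors
  \<open>(u, v, u, v)\<close> and a block on the odd vectors \<open>(u, v, -u, -v)\<close>, and all four eigenvalues can be
  read off (\<open>charpoly_half_turn_invariant\<close>).  With \<open>a = \<mu>$1\<close> and \<open>b = \<mu>$2\<close> they are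

    \<^item> \<open>0, 2 * a * b, a * (b - 3/2 * a), b * (a - 3/2 * b)\<close> for the Hessian,
    \<^item> \<open>0, a + b, b - 3/2 * a, a - 3/2 * b\<close> for the weighted Hessian.

  In the first list the last two entries vanish exactly when \<open>2 * b = 3 * a\<close> and
  \<open>2 * a = 3 * b\<close> respectively, while \<open>2 * a * b\<close> is never zero.  In the second list the last two entries
  add up to \<open>-(a + b)/2\<close>, so the three entries after the zero cannot all be positive.
\<close>

section \<open>Determinants and characteristic polynomials of four-by-four matrices\<close>

text \<open>The Laplace expansion along the first row, with the minors expanded in turn.\<close>

lemma det_4:
  "det (A::'a::comm_ring_1^4^4) =
    A$1$1 * (A$2$2 * (A$3$3 * A$4$4 - A$3$4 * A$4$3) - A$2$3 * (A$3$2 * A$4$4 - A$3$4 * A$4$2)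
             + A$2$4 * (A$3$2 * A$4$3 - A$3$3 * A$4$2))
  - A$1$2 * (A$2$1 * (A$3$3 * A$4$4 - A$3$4 * A$4$3) - A$2$3 * (A$3$1 * A$4$4 - A$3$4 * A$4$1)
             + A$2$4 * (A$3$1 * A$4$3 - A$3$3 * A$4$1))
  + A$1$3 * (A$2$1 * (A$3$2 * A$4$4 - A$3$4 * A$4$2) - A$2$2 * (A$3$1 * A$4$4 - A$3$4 * A$4$1)
             + A$2$4 * (A$3$1 * A$4$2 - A$3$2 * A$4$1))
  - A$1$4 * (A$2$1 * (A$3$2 * A$4$3 - A$3$3 * A$4$2) - A$2$2 * (A$3$1 * A$4$3 - A$3$3 * A$4$1)
             + A$2$3 * (A$3$1 * A$4$2 - A$3$2 * A$4$1))"
proof -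
  have f1234: "finite {2::4, 3, 4}" "1 \<notin> {2::4, 3, 4}"
    by auto
  have f234: "finite {3::4, 4}" "2 \<notin> {3::4, 4}"
    by auto
  have f34: "finite {4::4}" "3 \<notin> {4::4}"
    by auto
  show ?thesis
    unfolding det_def UNIV_4
    unfolding sum_over_permutations_insert[OF f1234]
    unfolding sum_over_permutations_insert[OF f234]
    unfolding sum_over_permutations_insert[OF f34]
    unfolding permutes_sing
    by (simp add: sign_swap_id permutation_swap_id permutation_compose sign_compose sign_id swap_id_eq)
       (simp add: algebra_simps)
qed

lemma vector_4:
  "(vector [w,x,y,z] :: 'a::zero^4)$1 = w"
  "(vector [w,x,y,z] :: 'a::zero^4)$2 = x"
  "(vector [w,x,y,z] :: 'a::zero^4)$3 = y"
  "(vector [w,x,y,z] :: 'a::zero^4)$4 = z"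
  by (simp_all add: vector_def)

lemma poly_det:
  fixes M :: "'a::comm_ring_1 poly^'n^'n"
  shows "poly (det M) t = det (\<chi> i j. poly (M$i$j) t)"
  by (simp add: det_def poly_sum poly_prod)

lemma poly_charpoly: "poly (charpoly A) t = det (mat t - A)"
proof -
  have "poly (charpoly A) t = det (\<chi> i j. poly ((mat [:0, 1:] - (\<chi> i j. [:A$i$j:])) $ i $ j) t)"
    unfolding charpoly_def by (rule poly_det)
  also have "\<dots> = det (mat t - A)"
    by (intro arg_cong[of _ _ det]) (simp add: vec_eq_iff mat_def)
  finally show ?thesis .
qed

text \<open>
  A matrix of this shape commutes with the half turn that exchanges the indices 1 and 3 and the
  indices 2 and 4.  It therefore preserves the odd vectors \<open>(u, v, -u, -v)\<close>, on which it is diagonal with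
  entries \<open>x - z\<close> and \<open>x' - z'\<close>, and the even vectors \<open>(u, v, u, v)\<close>, on which it acts as the
  two-by-two matrix with rows \<open>(-2y, 2y)\<close> and \<open>(2y', -2y')\<close>, because the row sums vanish.  The
  latter has determinant 0 and trace \<open>-2y - 2y'\<close>.
\<close>

lemma charpoly_half_turn_invariant:
  fixes x y z x' y' z' :: real
  assumes "x + 2 * y + z = 0" and "x' + 2 * y' + z' = 0"
  shows "charpoly (vector [vector [x, y, z, y], vector [y', x', y', z'],
                           vector [z, y, x, y], vector [y', z', y', x']] :: real^4^4) =
    (\<Prod>r\<leftarrow>[0, - 2 * y - 2 * y', x - z, x' - z']. [:- r, 1:])"
proof (rule poly_ext)
  have x: "x = - 2 * y - z" "x' = - 2 * y' - z'"
    using assms by simp_all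
  fix t
  show "poly (charpoly (vector [vector [x, y, z, y], vector [y', x', y', z'],
                                vector [z, y, x, y], vector [y', z', y', x']] :: real^4^4)) t =
    poly (\<Prod>r\<leftarrow>[0, - 2 * y - 2 * y', x - z, x' - z']. [:- r, 1:]) t"
    unfolding poly_charpoly by (simp add: det_4 mat_def vector_4 x) algebra
qed

section \<open>Counting eigenvalues from a factored characteristic polynomial\<close>

lemma order_prod_list_linear:
  fixes rs :: "real list"
  shows "order x (\<Prod>r\<leftarrow>rs. [:- r, 1:]) = count_list rs x"
proof (induction rs)
  case Nil
  then show ?case by simp
next
  case (Cons r rs)
  have nz: "[:- r, 1:] * (\<Prod>r\<leftarrow>rs. [:- r, 1:]) \<noteq> 0"
    unfolding mult_eq_0_iff prod_list_zero_iff by auto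
  have "order x [:- r, 1:] = (if r = x then 1 else 0)"
  proof (cases "r = x")
    case True
    then show ?thesis using order_power_n_n[of x 1] by simp
  next
    case False
    then show ?thesis by (simp add: order_0I)
  qed
  with Cons order_mult[OF nz] show ?case by simp
qed

text \<open>
  Summing the multiplicities over the distinct roots in \<open>S\<close> counts the entries of the list that lie
  in \<open>S\<close>.  Thus a factorisation turns both spectral conditions into inequalities between listed
  numbers, also when some of these coincide.
\<close>

lemma eigenvalue_count_eq_length_filter:
  assumes "charpoly A = (\<Prod>r\<leftarrow>rs. [:- r, 1:])"
  shows "eigenvalue_count A S = length (filter (\<lambda>r. r \<in> S) rs)"
proof -
  have roots: "{x. x \<in> S \<and> poly (charpoly A) x = 0} = set (filter (\<lambda>r. r \<in> S) rs)"
  proof -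
    have "poly (\<Prod>r\<leftarrow>rs. [:- r, 1:]) x = 0 \<longleftrightarrow> x \<in> set rs" for x
      by (induction rs) (auto simp: algebra_simps)
    then show ?thesis
      by (auto simp: assms)
  qed
  have cnt: "count_list rs x = count_list (filter (\<lambda>r. r \<in> S) rs) x"
    if "x \<in> S" for x
    using that by (induction rs) auto
  have "eigenvalue_count A S = (\<Sum>x\<in>set (filter (\<lambda>r. r \<in> S) rs). count_list rs x)"
    unfolding eigenvalue_count_def roots
    by (simp add: assms order_prod_list_linear)
  also have "\<dots> = sum (count_list (filter (\<lambda>r. r \<in> S) rs)) (set (filter (\<lambda>r. r \<in> S) rs))"
    using cnt by (intro sum.cong) auto
  also have "\<dots> = length (filter (\<lambda>r. r \<in> S) rs)"
    by (rule sum_count_set) auto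
  finally show ?thesis .
qed

section \<open>First and second derivatives of the potential\<close>

abbreviation interaction :: "real \<Rightarrow> real"
  where "interaction \<phi> \<equiv> cos \<phi> + 1/2 * ln (2 - 2 * cos \<phi>)"

definition interaction' :: "real \<Rightarrow> real" where
  "interaction' \<phi> = - sin \<phi> + sin \<phi> / (2 * (1 - cos \<phi>))"

definition interaction'' :: "real \<Rightarrow> real" where
  "interaction'' \<phi> = - cos \<phi> - 1 / (2 * (1 - cos \<phi>))"

lemma interaction_derivative:
  assumes "cos \<phi> \<noteq> 1"
  shows "(interaction has_real_derivative interaction' \<phi>) (at \<phi>)"
proof -
  have "cos \<phi> < 1" using assms cos_le_one[of \<phi>] by linarith
  then show ?thesis
    unfolding interaction'_def
    by (auto intro!: derivative_eq_intros simp: field_simps)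
qed

lemma interaction'_derivative:
  assumes "cos \<phi> \<noteq> 1"
  shows "(interaction' has_real_derivative interaction'' \<phi>) (at \<phi>)"
proof -
  have s: "sin \<phi> * sin \<phi> = 1 - cos \<phi> * cos \<phi>"
    using sin_cos_squared_add[of \<phi>] by (simp add: power2_eq_square)
  have "(interaction' has_real_derivative
      - cos \<phi> + (cos \<phi> * (2 * (1 - cos \<phi>)) - sin \<phi> * (2 * sin \<phi>)) / (2 * (1 - cos \<phi>))\<^sup>2) (at \<phi>)"
    unfolding interaction'_def using assms
    by (auto intro!: derivative_eq_intros simp: power2_eq_square)
  also have "cos \<phi> * (2 * (1 - cos \<phi>)) - sin \<phi> * (2 * sin \<phi>) = - 2 * (1 - cos \<phi>)"
    using s by algebra
  also have "- cos \<phi> + - 2 * (1 - cos \<phi>) / (2 * (1 - cos \<phi>))\<^sup>2 = interaction'' \<phi>"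
    using assms unfolding interaction''_def by (simp add: power2_eq_square divide_simps) algebra
  finally show ?thesis .
qed

lemma sum_vortex_pairs:
  fixes g :: "4 \<times> 4 \<Rightarrow> 'a::comm_monoid_add"
  shows "sum g vortex_pairs =
    g (1,2) + (g (1,3) + (g (1,4) + (g (2,3) + (g (2,4) + g (3,4)))))"
  by (simp add: vortex_pairs_def)

text \<open>
  This form of admissibility is what differentiation uses: it says that no logarithm and no
  denominator is singular, and it is visibly an open condition.
\<close>

definition collision_free :: "real^4 \<Rightarrow> bool" where
  "collision_free \<theta> \<longleftrightarrow> (\<forall>(i,j)\<in>vortex_pairs. cos (\<theta>$i - \<theta>$j) \<noteq> 1)"

text \<open>
  The weights \<open>c\<close> and the interaction \<open>f\<close> are arbitrary because a partial derivative of such a sum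
  is again a sum of this form, with \<open>f'\<close> as interaction and with the coordinate differences of the
  direction absorbed into the weights.  The rule thus yields the gradient and then the Hessian.
\<close>

lemma has_derivative_pair_sum:
  fixes c :: "4 \<Rightarrow> 4 \<Rightarrow> real" and f f' :: "real \<Rightarrow> real"
  assumes f: "\<And>\<phi>. cos \<phi> \<noteq> 1 \<Longrightarrow> (f has_real_derivative f' \<phi>) (at \<phi>)"
    and \<theta>: "collision_free \<theta>"
  shows "((\<lambda>\<theta>. \<Sum>(i,j)\<in>vortex_pairs. c i j * f (\<theta>$i - \<theta>$j)) has_derivative
          (\<lambda>h. \<Sum>(i,j)\<in>vortex_pairs. c i j * f' (\<theta>$i - \<theta>$j) * (h$i - h$j))) (at \<theta>)"
proof -
  have "((\<lambda>\<theta>. c i j * f (\<theta>$i - \<theta>$j)) has_derivative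
          (\<lambda>h. c i j * f' (\<theta>$i - \<theta>$j) * (h$i - h$j))) (at \<theta>)"
    if ij: "(i, j) \<in> vortex_pairs" for i j
  proof -
    have "(f has_real_derivative f' (\<theta>$i - \<theta>$j)) (at (\<theta>$i - \<theta>$j))"
      using \<theta> ij by (auto simp: collision_free_def intro!: f)
    then have "(f has_derivative (\<lambda>s. s * f' (\<theta>$i - \<theta>$j))) (at (\<theta>$i - \<theta>$j))"
      by (simp add: has_field_derivative_def mult_commute_abs)
    moreover have "((\<lambda>\<theta>. \<theta>$i - \<theta>$j) has_derivative (\<lambda>h. h$i - h$j)) (at \<theta>)"
      by (intro bounded_linear_imp_has_derivative bounded_linear_sub bounded_linear_vec_nth)
    ultimately have "((\<lambda>\<theta>. f (\<theta>$i - \<theta>$j)) has_derivative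
        (\<lambda>h. (h$i - h$j) * f' (\<theta>$i - \<theta>$j))) (at \<theta>)"
      using has_derivative_compose by fast
    from has_derivative_mult_right[OF this, of "c i j"] show ?thesis
      by (simp add: mult_ac)
  qed
  then show ?thesis
    by (auto intro!: has_derivative_sum simp: case_prod_unfold)
qed

lemma partial_deriv_eq:
  assumes "(f has_derivative f') (at x)"
  shows "partial_deriv i f x = f' (axis i 1)"
proof -
  have "((\<lambda>t. f (x + t *\<^sub>R axis i 1)) has_derivative (\<lambda>s. f' (s *\<^sub>R axis i 1))) (at 0)"
    by (rule has_derivative_compose[of "\<lambda>t. x + t *\<^sub>R axis i 1"])
       (auto intro!: derivative_eq_intros simp: assms)
  moreover have "f' (s *\<^sub>R axis i 1) = s * f' (axis i 1)" for s
    using linear_cmul[OF has_derivative_linear[OF assms]] by simp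
  ultimately show ?thesis
    by (auto simp: partial_deriv_def has_field_derivative_def mult_commute_abs intro!: DERIV_imp_deriv)
qed

text \<open>
  The second partial derivatives at \<open>x\<close> are computed from a formula for the first ones which holds
  only near \<open>x\<close>, away from collisions.
\<close>

lemma partial_deriv_cong:
  assumes "eventually (\<lambda>y. f y = g y) (nhds x)"
  shows "partial_deriv i f x = partial_deriv i g x"
proof -
  have "((\<lambda>t. x + t *\<^sub>R axis i 1) \<longlongrightarrow> x + 0 *\<^sub>R axis i 1) (nhds 0)"
    by (intro tendsto_intros filterlim_ident)
  then have "filterlim (\<lambda>t. x + t *\<^sub>R axis i 1) (nhds x) (nhds 0)"
    by simp
  with assms have "eventually (\<lambda>t. f (x + t *\<^sub>R axis i 1) = g (x + t *\<^sub>R axis i 1)) (nhds (0::real))"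
    by (rule eventually_compose_filterlim)
  then show ?thesis
    unfolding partial_deriv_def by (intro deriv_cong_ev) auto
qed

lemma eventually_collision_free:
  assumes "collision_free \<theta>"
  shows "eventually collision_free (nhds \<theta>)"
proof -
  have "eventually (\<lambda>\<eta>. cos (\<eta>$i - \<eta>$j) \<noteq> 1) (nhds \<theta>)" if "(i, j) \<in> vortex_pairs" for i j
  proof (rule tendsto_imp_eventually_ne)
    show "((\<lambda>\<eta>. cos (\<eta>$i - \<eta>$j)) \<longlongrightarrow> cos (\<theta>$i - \<theta>$j)) (nhds \<theta>)"
      by (intro tendsto_intros filterlim_ident)
    show "cos (\<theta>$i - \<theta>$j) \<noteq> 1"
      using assms that by (auto simp: collision_free_def)
  qed
  moreover have "finite vortex_pairs"
    by (simp add: vortex_pairs_def)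
  ultimately have "eventually (\<lambda>\<eta>. \<forall>p\<in>vortex_pairs. cos (\<eta>$(fst p) - \<eta>$(snd p)) \<noteq> 1) (nhds \<theta>)"
    by (intro eventually_ball_finite) auto
  then show ?thesis
    by (simp add: collision_free_def[abs_def] case_prod_unfold)
qed

lemma vortex_potential_has_derivative:
  assumes "collision_free \<theta>"
  shows "(vortex_potential \<mu> has_derivative
    (\<lambda>h. - (\<Sum>(i,j)\<in>vortex_pairs. \<mu>$i * \<mu>$j * interaction' (\<theta>$i - \<theta>$j) * (h$i - h$j)))) (at \<theta>)"
  unfolding vortex_potential_def[abs_def]
  by (intro has_derivative_minus has_derivative_pair_sum[where c = "\<lambda>i j. \<mu>$i * \<mu>$j"]
      interaction_derivative assms)

text \<open>
  The factors \<open>axis k 1 $ i - axis k 1 $ j\<close> are the derivatives of \<open>\<theta>$i - \<theta>$j\<close> in the coordinate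
  \<open>k\<close>; they vanish unless the pair contains the vortex \<open>k\<close>.
\<close>

lemma hessian_vortex_potential:
  assumes "collision_free \<theta>"
  shows "hessian (vortex_potential \<mu>) \<theta> $ k $ l =
    - (\<Sum>(i,j)\<in>vortex_pairs. \<mu>$i * \<mu>$j * interaction'' (\<theta>$i - \<theta>$j) *
        (axis k 1 $ i - axis k 1 $ j) * (axis l 1 $ i - axis l 1 $ j))"
proof -
  \<comment> \<open>the partial derivative in the coordinate \<open>l\<close>, as a pair sum with signed weights\<close>
  let ?G = "\<lambda>\<theta>. \<Sum>(i,j)\<in>vortex_pairs.
      - (\<mu>$i * \<mu>$j * (axis l 1 $ i - axis l 1 $ j)) * interaction' (\<theta>$i - \<theta>$j)"
  have "eventually (\<lambda>\<eta>. partial_deriv l (vortex_potential \<mu>) \<eta> = ?G \<eta>) (nhds \<theta>)"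
    using eventually_collision_free[OF assms]
  proof eventually_elim
    case (elim \<eta>)
    show ?case
      by (subst partial_deriv_eq[OF vortex_potential_has_derivative[OF elim]])
         (simp add: sum_vortex_pairs algebra_simps)
  qed
  then have "hessian (vortex_potential \<mu>) \<theta> $ k $ l = partial_deriv k ?G \<theta>"
    by (simp add: hessian_def partial_deriv_cong)
  also have "\<dots> = (\<Sum>(i,j)\<in>vortex_pairs. - (\<mu>$i * \<mu>$j * (axis l 1 $ i - axis l 1 $ j)) *
      interaction'' (\<theta>$i - \<theta>$j) * (axis k 1 $ i - axis k 1 $ j))"
    by (rule partial_deriv_eq
        [OF has_derivative_pair_sum[where c = "\<lambda>i j. - (\<mu>$i * \<mu>$j * (axis l 1 $ i - axis l 1 $ j))"]])
       (use assms in \<open>auto intro: interaction'_derivative\<close>)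
  also have "\<dots> = - (\<Sum>(i,j)\<in>vortex_pairs. \<mu>$i * \<mu>$j * interaction'' (\<theta>$i - \<theta>$j) *
        (axis k 1 $ i - axis k 1 $ j) * (axis l 1 $ i - axis l 1 $ j))"
    unfolding sum_negf[symmetric] by (intro sum.cong) (auto simp: mult_ac)
  finally show ?thesis .
qed

lemma cos_diff_eq_1_if_rcong:
  assumes "[x = y] (rmod (2 * pi))"
  shows "cos (x - y) = 1"
proof -
  obtain n :: int where "x = y + of_int n * (2 * pi)"
    using assms rcong_sym unfolding rcong_altdef by blast
  then show ?thesis
    by (auto simp: cos_one_2pi_int mult_ac)
qed

lemma admissible_if_collision_free:
  assumes "collision_free \<theta>"
  shows "admissible \<theta>"
proof -
  have "cos (\<theta>$i - \<theta>$j) \<noteq> 1" if "i \<noteq> j" for i j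
  proof -
    have "(i, j) \<in> vortex_pairs \<or> (j, i) \<in> vortex_pairs"
      using that exhaust_4[of i] exhaust_4[of j] by (auto simp: vortex_pairs_def)
    moreover have "cos (\<theta>$j - \<theta>$i) = cos (\<theta>$i - \<theta>$j)"
      by (metis cos_minus minus_diff_eq)
    ultimately show ?thesis
      using assms by (auto simp: collision_free_def)
  qed
  then show ?thesis
    unfolding admissible_def using cos_diff_eq_1_if_rcong by blast
qed

lemma weighted_hessian_nth:
  assumes "\<And>i. \<mu>$i \<noteq> 0"
  shows "weighted_hessian \<mu> \<theta> $ i $ j = hessian (vortex_potential \<mu>) \<theta> $ i $ j / \<mu>$i"
proof -
  let ?D = "diag_matrix \<mu>" and ?H = "hessian (vortex_potential \<mu>) \<theta>"
  have nth: "(diag_matrix d ** M) $ i $ j = d$i * M$i$j" for d :: "real^4" and M :: "real^4^4" and i j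
    by (simp add: matrix_matrix_mult_def diag_matrix_def if_distrib[of "\<lambda>x. x * _"] cong: if_cong)
  have eq: "?D ** diag_matrix (\<chi> i. 1 / \<mu>$i) = mat 1"
    using assms by (simp add: vec_eq_iff nth) (simp add: diag_matrix_def mat_def)
  then have inv: "\<exists>B. ?D ** B = mat 1 \<and> B ** ?D = mat 1"
    using invertible_right_inverse unfolding invertible_def by blast
  have "?D ** matrix_inv ?D = mat 1 \<and> matrix_inv ?D ** ?D = mat 1"
    unfolding matrix_inv_def by (rule someI_ex[OF inv])
  then have "?D ** weighted_hessian \<mu> \<theta> = ?H"
    by (simp add: weighted_hessian_def matrix_mul_assoc)
  then have "\<mu>$i * weighted_hessian \<mu> \<theta> $ i $ j = ?H $ i $ j"
    by (metis nth)
  then show ?thesis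
    using assms[of i] by (simp add: field_simps)
qed

section \<open>The square configuration\<close>

lemma square_cos_sin:
  fixes sq defines "sq \<equiv> square_configuration"
  shows "cos (sq$1 - sq$2) = 0" "cos (sq$1 - sq$3) = - 1" "cos (sq$1 - sq$4) = 0"
    "cos (sq$2 - sq$3) = 0" "cos (sq$2 - sq$4) = - 1" "cos (sq$3 - sq$4) = 0"
    and "sin (sq$1 - sq$2) = - 1" "sin (sq$1 - sq$3) = 0" "sin (sq$1 - sq$4) = 1"
    "sin (sq$2 - sq$3) = - 1" "sin (sq$2 - sq$4) = 0" "sin (sq$3 - sq$4) = - 1"
proof -
  have diff: "sq$1 - sq$2 = - (pi / 2)" "sq$1 - sq$3 = - pi" "sq$1 - sq$4 = - (3 / 2 * pi)"
    "sq$2 - sq$3 = - (pi / 2)" "sq$2 - sq$4 = - pi" "sq$3 - sq$4 = - (pi / 2)"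
    by (simp_all add: sq_def square_configuration_def vector_4)
  show "cos (sq$1 - sq$2) = 0" "cos (sq$1 - sq$3) = - 1" "cos (sq$1 - sq$4) = 0"
    "cos (sq$2 - sq$3) = 0" "cos (sq$2 - sq$4) = - 1" "cos (sq$3 - sq$4) = 0"
    "sin (sq$1 - sq$2) = - 1" "sin (sq$1 - sq$3) = 0" "sin (sq$1 - sq$4) = 1"
    "sin (sq$2 - sq$3) = - 1" "sin (sq$2 - sq$4) = 0" "sin (sq$3 - sq$4) = - 1"
    unfolding diff cos_minus sin_minus cos_3over2_pi sin_3over2_pi by simp_all
qed

lemma collision_free_square: "collision_free square_configuration"
  by (simp add: collision_free_def vortex_pairs_def square_cos_sin)

lemma critical_point_square:
  assumes "\<mu>$3 = \<mu>$1" and "\<mu>$4 = \<mu>$2"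
  shows "critical_point \<mu> square_configuration"
proof -
  have "(\<Sum>(i,j)\<in>vortex_pairs. \<mu>$i * \<mu>$j *
      interaction' (square_configuration$i - square_configuration$j) * (h$i - h$j)) = 0" for h
    using assms
    by (simp add: sum_vortex_pairs square_cos_sin interaction'_def algebra_simps diff_divide_distrib)
  with vortex_potential_has_derivative[OF collision_free_square, of \<mu>] show ?thesis
    by (simp add: critical_point_def collision_free_square admissible_if_collision_free)
qed

text \<open>
  Off the diagonal, neighbours contribute the weighted second derivative \<open>-1/2\<close> and opposite
  vortices \<open>3/4\<close>; the diagonal makes the row sums vanish, which is the rotation invariance of the
  potential.
\<close>

lemma hessian_square:
  assumes "\<mu>$1 = a" "\<mu>$2 = b" "\<mu>$3 = a" "\<mu>$4 = b"
  shows "hessian (vortex_potential \<mu>) square_configuration =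
    (let x = a * b - 3/4 * a\<^sup>2; y = - (a * b / 2); z = 3/4 * a\<^sup>2;
         x' = a * b - 3/4 * b\<^sup>2; z' = 3/4 * b\<^sup>2
     in vector [vector [x, y, z, y], vector [y, x', y, z'],
                vector [z, y, x, y], vector [y, z', y, x']])"
  unfolding vec_eq_iff forall_4 Let_def
  by (simp add: hessian_vortex_potential[OF collision_free_square] sum_vortex_pairs
      square_cos_sin interaction''_def vector_4 axis_def assms power2_eq_square)

lemma weighted_hessian_square:
  assumes "\<mu>$1 = a" "\<mu>$2 = b" "\<mu>$3 = a" "\<mu>$4 = b" and "a \<noteq> 0" "b \<noteq> 0"
  shows "weighted_hessian \<mu> square_configuration =
    (let x = b - 3/4 * a; y = - (b / 2); z = 3/4 * a;
         x' = a - 3/4 * b; y' = - (a / 2); z' = 3/4 * b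
     in vector [vector [x, y, z, y], vector [y', x', y', z'],
                vector [z, y, x, y], vector [y', z', y', x']])"
proof -
  have "\<mu>$i \<noteq> 0" for i
    using exhaust_4[of i] assms by auto
  then show ?thesis
    using assms(5,6) unfolding vec_eq_iff forall_4 Let_def
    by (simp add: weighted_hessian_nth hessian_square[OF assms(1-4)] Let_def vector_4 assms(1-4)
        power2_eq_square diff_divide_distrib)
qed

theorem theorem6:
  fixes \<mu> :: "real^4"
  assumes "\<mu>$1 \<noteq> 0" and "\<mu>$2 \<noteq> 0" and "\<mu>$3 = \<mu>$1" and "\<mu>$4 = \<mu>$2"
  shows "critical_point \<mu> square_configuration
    \<and> (nondegenerate \<mu> square_configuration \<longleftrightarrow>
         \<not> (2 * \<mu>$1 = 3 * \<mu>$2 \<or> 3 * \<mu>$1 = 2 * \<mu>$2))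
    \<and> \<not> linearly_stable \<mu> square_configuration"
proof (intro conjI)
  define a b where "a = \<mu>$1" and "b = \<mu>$2"
  have ab: "\<mu>$1 = a" "\<mu>$2 = b" "\<mu>$3 = a" "\<mu>$4 = b" and nz: "a \<noteq> 0" "b \<noteq> 0"
    using assms by (simp_all add: a_def b_def)
  show "critical_point \<mu> square_configuration"
    using assms by (intro critical_point_square)
  \<comment> \<open>Products of linear factors are compared through their root lists, not by multiplying out.\<close>
  have prod_linear_cong: "(\<Prod>r\<leftarrow>rs. [:- r, 1:]) = (\<Prod>r\<leftarrow>rs'. [:- r, 1:])" if "rs = rs'"
    for rs rs' :: "real list"
    using that by simp
  have "charpoly (hessian (vortex_potential \<mu>) square_configuration) =
      (\<Prod>r\<leftarrow>[0, 2 * a * b, a * (b - 3/2 * a), b * (a - 3/2 * b)]. [:- r, 1:])"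
    unfolding hessian_square[OF ab] Let_def
    by (rule trans[OF charpoly_half_turn_invariant prod_linear_cong])
       (simp_all add: power2_eq_square algebra_simps)
  from eigenvalue_count_eq_length_filter[OF this, of "{0}"] nz
  show "nondegenerate \<mu> square_configuration \<longleftrightarrow>
      \<not> (2 * \<mu>$1 = 3 * \<mu>$2 \<or> 3 * \<mu>$1 = 2 * \<mu>$2)"
    by (auto simp: nondegenerate_def ab)
  have "charpoly (weighted_hessian \<mu> square_configuration) =
      (\<Prod>r\<leftarrow>[0, a + b, b - 3/2 * a, a - 3/2 * b]. [:- r, 1:])"
    unfolding weighted_hessian_square[OF ab nz] Let_def
    by (rule trans[OF charpoly_half_turn_invariant prod_linear_cong])
       (simp_all add: algebra_simps)
  \<comment> \<open>The last two eigenvalues add up to \<open>-1/2\<close> times the second, which excludes three positive ones.\<close>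
  from eigenvalue_count_eq_length_filter[OF this, of "{0<..}"]
  show "\<not> linearly_stable \<mu> square_configuration"
    by (auto simp: linearly_stable_def)
qed

end
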